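(* Let $(X,d)$ be a proper Polish metric space, let $p\in[1,\infty)$, let $r>0$, and let $\nu\in\mathcal{P}(X)$ have a finite $p$-th moment. Let $f:X\to\mathbb{R}$ be upper semi-continuous and such that for each $\mu\in\mathcal{B}_r(\nu)$ at least one of the integrals $\int_X[f(x)]_+\,\mathrm{d}\mu(x)$ and $\int_X[-f(x)]_+\,\mathrm{d}\mu(x)$ is finite. Then the optimal value $$\sup\left\{\int_X f(x)\,\mathrm{d}\mu(x):\ \mu\in\mathcal{B}_r(\nu)\right\}$$ is finite if and only if there exist $x_0\in X$ and $c>0$ such that $f(x)\le c\,[1+d^p(x,x_0)]$ for all $x\in X$.
   Context: A Polish metric space is a complete and separable metric space. $(X,d)$ is proper if every closed ball $\{x\in X: d(x,x_0)\le R\}$, with $R>0$ and $x_0\in X$, is compact. $\mathcal{P}(X)$ is the set of all Borel probability measures on $X$. For $\mu_1,\mu_2\in\mathcal{P}(X)$, $$W_p(\mu_1,\mu_2)=\inf_{\gamma\in\Gamma(\mu_1,\mu_2)}\left(\int_{X\times X}d^p(x_1,x_2)\,\mathrm{d}\gamma(x_1,x_2)\right)^{1/p}\in[0,\infty],$$ where $\Gamma(\mu_1,\mu_2)$ is the set of probability measures on $X\times X$ with marginals $\mu_1$ and $\mu_2$. The Wasserstein ball is $\mathcal{B}_r(\nu)=\{\mu\in\mathcal{P}(X):W_p(\mu,\nu)\le r\}$. A measure $\mu\in\mathcal{P}(X)$ has a finite $p$-th moment if $\int_X d^p(x,x_0)\,\mathrm{d}\mu(x)<\infty$ for some (equivalently,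 every) $x_0\in X$. $[t]_+=\max\{t,0\}$. Integrals $\int_X f\,\mathrm{d}\mu=\int_X[f]_+\,\mathrm{d}\mu-\int_X[-f]_+\,\mathrm{d}\mu$ take values in $[-\infty,+\infty]$; "finite" means a real number. *)

theory Defs
  imports "HOL-Probability.Probability"
begin

definition borel_probs :: "'a::topological_space measure set" where
  "borel_probs = {\<mu>. sets \<mu> = sets borel \<and> prob_space \<mu>}"

text \<open>For a second-countable space the Borel sigma-algebra of the product coincides with the
  product of the Borel sigma-algebras (\<open>borel_prod\<close>).\<close>

definition couplings ::
    "'a::polish_space measure \<Rightarrow> 'a measure \<Rightarrow> ('a \<times> 'a) measure set" where
  "couplings \<mu>1 \<mu>2 =
     {\<gamma> \<in> borel_probs. distr \<gamma> borel fst = \<mu>1 \<and> distr \<gamma> borel snd = \<mu>2}"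

text \<open>Real powers on \<open>[0, \<infinity>]\<close>; only used with a positive exponent.\<close>

definition ennreal_powr :: "ennreal \<Rightarrow> real \<Rightarrow> ennreal" where
  "ennreal_powr t a = (if t = \<infinity> then \<infinity> else ennreal (enn2real t powr a))"

definition wasserstein ::
    "real \<Rightarrow> 'a::polish_space measure \<Rightarrow> 'a measure \<Rightarrow> ennreal" where
  "wasserstein p \<mu>1 \<mu>2 =
     (INF \<gamma> \<in> couplings \<mu>1 \<mu>2.
        ennreal_powr (\<integral>\<^sup>+ z. ennreal (dist (fst z) (snd z) powr p) \<partial>\<gamma>) (1 / p))"

definition wasserstein_ball ::
    "real \<Rightarrow> real \<Rightarrow> 'a::polish_space measure \<Rightarrow> 'a measure set" where
  "wasserstein_ball p r \<nu> = {\<mu> \<in> borel_probs. wasserstein p \<mu> \<nu> \<le> ennreal r}"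

definition finite_moment :: "real \<Rightarrow> 'a::metric_space measure \<Rightarrow> bool" where
  "finite_moment p \<mu> \<longleftrightarrow> (\<exists>x0. (\<integral>\<^sup>+ x. ennreal (dist x x0 powr p) \<partial>\<mu>) < \<infinity>)"

definition upper_semicontinuous :: "('a::topological_space \<Rightarrow> real) \<Rightarrow> bool" where
  "upper_semicontinuous f \<longleftrightarrow> (\<forall>x y. f x < y \<longrightarrow> (\<forall>\<^sub>F z in nhds x. f z < y))"

text \<open>The integral with values in \<open>[-\<infinity>, \<infinity>]\<close>. It is meaningful only if at least one of
  the two parts is finite: the type \<open>ereal\<close> evaluates \<open>\<infinity> - \<infinity>\<close> to \<open>\<infinity>\<close>.\<close>

definition ext_integral :: "'a measure \<Rightarrow> ('a \<Rightarrow> real) \<Rightarrow> ereal" where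
  "ext_integral \<mu> f =
     enn2ereal (\<integral>\<^sup>+ x. ennreal (max (f x) 0) \<partial>\<mu>)
     - enn2ereal (\<integral>\<^sup>+ x. ennreal (max (- f x) 0) \<partial>\<mu>)"

end

theory Submission
  imports Defs
begin

text \<open>Both directions rest on one family of measures. Since \<open>\<nu>\<close> has a finite \<open>p\<close>-th moment, it
  can be moved by a Borel map \<open>T\<close> of finite range to a measure \<open>\<mu>0\<close> at cost at most \<open>r\<^sup>p / 2\<close>
  (\<open>finite_range_approximation\<close>). A small fraction \<open>e\<close> of the mass may then be sent to any
  point \<open>x\<close>: the transport cost of the mixture \<open>(1 - e) \<mu>0 + e \<delta>\<^sub>x\<close> grows by at most a constant times
  \<open>e (1 + d(x, x0)\<^sup>p)\<close>, so the mixture stays in the ball for some \<open>e\<close> that is at least a fixed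
  multiple of \<open>1 / (1 + d(x, x0)\<^sup>p)\<close>. Its support is finite, so all integrals over it are finite,
  and the contribution of \<open>\<mu>0\<close> to the negative part of the integral of \<open>f\<close> is bounded
  by a constant \<open>K\<close> independent of \<open>x\<close> (\<open>ball_contains_perturbation_toward_point\<close>).

  If the supremum is a real number \<open>S\<close>, then testing it with these mixtures gives
  \<open>e f(x) \<le> S + K\<close> wherever \<open>f(x) > 0\<close>, and dividing by \<open>e\<close> is exactly the growth condition.

  Conversely, under the growth condition the integrals of the positive part of \<open>f\<close> are bounded by
  \<open>p\<close>-th moments, and these are uniformly bounded on the ball by the triangle inequality
  (\<open>ball_uniform_integral_bound\<close>). This bounds the supremum from above. It is also not \<open>-\<infinity>\<close>: the
  integral of \<open>f\<close> against \<open>\<nu>\<close> itself may be \<open>-\<infinity>\<close>, as \<open>f\<close> can decrease arbitrarily fast, but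
  the ball contains a finitely supported measure.\<close>

section \<open>Measurability\<close>

lemma usc_borel_measurable:
  fixes f :: "'a::topological_space \<Rightarrow> real"
  assumes "upper_semicontinuous f"
  shows "f \<in> borel_measurable borel"
proof (rule borel_measurableI_less)
  fix y :: real
  have "open {x. f x < y}"
  proof (subst open_subopen, intro ballI)
    fix x assume "x \<in> {x. f x < y}"
    then have "\<forall>\<^sub>F z in nhds x. f z < y"
      using assms by (simp add: upper_semicontinuous_def)
    then obtain U where "open U" "x \<in> U" "\<forall>z\<in>U. f z < y"
      unfolding eventually_nhds by blast
    then show "\<exists>U. open U \<and> x \<in> U \<and> U \<subseteq> {x. f x < y}"
      by (intro exI[of _ U]) auto
  qed
  then show "{x \<in> space borel. f x < y} \<in> sets borel"
    by simp
qed

lemma measurable_proj_borel: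
  "fst \<in> measurable borel (borel :: 'a::topological_space measure)"
  "snd \<in> measurable borel (borel :: 'b::topological_space measure)"
  by (simp_all add: borel_measurable_continuous_onI continuous_on_fst continuous_on_snd)

section \<open>Transport plans and the Wasserstein ball\<close>

text \<open>Transport plans are given as pairs of random variables on an arbitrary probability space,
  so that a mixture of plans can be described by an additional coin toss.\<close>

lemma distr_in_wasserstein_ball:
  fixes X Y :: "'b \<Rightarrow> 'a::polish_space"
  assumes "prob_space N" and [measurable]: "X \<in> measurable N borel" "Y \<in> measurable N borel"
    and marginal: "distr N borel Y = \<nu>"
    and cost: "(\<integral>\<^sup>+ w. ennreal (dist (X w) (Y w) powr p) \<partial>N) \<le> ennreal (r powr p)"
    and p: "1 \<le> p" and r: "0 < r"
  shows "distr N borel X \<in> wasserstein_ball p r \<nu>"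
proof -
  interpret prob_space N by fact
  define \<gamma> where "\<gamma> = distr N borel (\<lambda>w. (X w, Y w))"
  have XY [measurable]: "(\<lambda>w. (X w, Y w)) \<in> measurable N borel"
    by (rule borel_measurable_Pair) auto
  note measurable_proj_borel [measurable]
  have "\<gamma> \<in> couplings (distr N borel X) \<nu>"
    unfolding couplings_def borel_probs_def \<gamma>_def marginal[symmetric]
    by (simp add: distr_distr prob_space_distr comp_def)
  then have "wasserstein p (distr N borel X) \<nu>
      \<le> ennreal_powr (\<integral>\<^sup>+ z. ennreal (dist (fst z) (snd z) powr p) \<partial>\<gamma>) (1 / p)"
    unfolding wasserstein_def by (rule INF_lower)
  also have "(\<integral>\<^sup>+ z. ennreal (dist (fst z) (snd z) powr p) \<partial>\<gamma>)
      = (\<integral>\<^sup>+ w. ennreal (dist (X w) (Y w) powr p) \<partial>N)"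
    unfolding \<gamma>_def by (subst nn_integral_distr) auto
  also have "ennreal_powr \<dots> (1 / p) \<le> ennreal r"
  proof -
    let ?I = "\<integral>\<^sup>+ w. ennreal (dist (X w) (Y w) powr p) \<partial>N"
    have "?I \<noteq> \<infinity>"
      using cost by (auto simp: top_unique)
    moreover have "enn2real ?I \<le> r powr p"
      using cost by (simp add: enn2real_leI)
    then have "enn2real ?I powr (1 / p) \<le> (r powr p) powr (1 / p)"
      using p by (intro powr_mono2) auto
    then have "enn2real ?I powr (1 / p) \<le> r"
      using p r by (simp add: powr_powr)
    ultimately show ?thesis
      by (simp add: ennreal_powr_def ennreal_leI)
  qed
  finally show ?thesis
    by (simp add: wasserstein_ball_def borel_probs_def prob_space_distr)
qed

text \<open>The radius grows by one because the infimum in the Wasserstein distance is not assumed to be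
  attained; any larger radius is reached by some coupling.\<close>

lemma wasserstein_ball_coupling:
  fixes \<mu> \<nu> :: "'a::polish_space measure"
  assumes "\<mu> \<in> wasserstein_ball p r \<nu>" and p: "1 \<le> p" and r: "0 < r"
  obtains \<gamma> where "\<gamma> \<in> couplings \<mu> \<nu>"
    "(\<integral>\<^sup>+ z. ennreal (dist (fst z) (snd z) powr p) \<partial>\<gamma>) \<le> ennreal ((r + 1) powr p)"
proof -
  have "wasserstein p \<mu> \<nu> \<le> ennreal r"
    using assms(1) by (simp add: wasserstein_ball_def)
  also have "ennreal r < ennreal (r + 1)"
    using r by (intro ennreal_lessI) auto
  finally obtain \<gamma> where \<gamma>: "\<gamma> \<in> couplings \<mu> \<nu>"
    and cost: "ennreal_powr (\<integral>\<^sup>+ z. ennreal (dist (fst z) (snd z) powr p) \<partial>\<gamma>) (1 / p) < ennreal (r + 1)"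
    unfolding wasserstein_def by (auto simp: INF_less_iff)
  let ?I = "\<integral>\<^sup>+ z. ennreal (dist (fst z) (snd z) powr p) \<partial>\<gamma>"
  from cost have fin: "?I \<noteq> \<infinity>"
    by (auto simp: ennreal_powr_def)
  with cost r have "enn2real ?I powr (1 / p) < r + 1"
    by (simp add: ennreal_powr_def ennreal_less_iff del: ennreal_plus)
  then have "(enn2real ?I powr (1 / p)) powr p \<le> (r + 1) powr p"
    using p by (intro powr_mono2) auto
  then have "enn2real ?I \<le> (r + 1) powr p"
    using p by (simp add: powr_powr)
  with fin have "?I \<le> ennreal ((r + 1) powr p)"
    by (metis ennreal_enn2real ennreal_leI infinity_ennreal_def less_top)
  with \<gamma> show ?thesis by (rule that)
qed

section \<open>Moments\<close>

lemma powr_add_le: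
  fixes a b p :: real
  assumes "0 \<le> a" "0 \<le> b" "0 \<le> p"
  shows "(a + b) powr p \<le> 2 powr p * (a powr p + b powr p)"
proof -
  have "(a + b) powr p \<le> (2 * max a b) powr p"
    using assms by (intro powr_mono2) auto
  also have "\<dots> = 2 powr p * max a b powr p"
    using assms by (simp add: powr_mult)
  also have "max a b powr p \<le> a powr p + b powr p"
    by (simp add: max_def)
  finally show ?thesis by simp
qed

lemma dist_powr_triangle:
  fixes x y z :: "'a::metric_space"
  assumes "0 \<le> p"
  shows "dist x z powr p \<le> 2 powr p * (dist x y powr p + dist y z powr p)"
proof -
  have "dist x z powr p \<le> (dist x y + dist y z) powr p"
    using assms by (intro powr_mono2) (auto intro: dist_triangle)
  also have "\<dots> \<le> 2 powr p * (dist x y powr p + dist y z powr p)"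
    using assms by (intro powr_add_le) auto
  finally show ?thesis .
qed

lemma moment_le_cost_plus_moment:
  fixes Y :: "'b \<Rightarrow> 'a::polish_space"
  assumes [measurable]: "X \<in> measurable N borel" "Y \<in> measurable N borel"
    and p: "1 \<le> p"
  shows "(\<integral>\<^sup>+ w. ennreal (dist (X w) x0 powr p) \<partial>N)
    \<le> ennreal (2 powr p) * ((\<integral>\<^sup>+ w. ennreal (dist (X w) (Y w) powr p) \<partial>N)
        + (\<integral>\<^sup>+ w. ennreal (dist (Y w) x0 powr p) \<partial>N))"
proof -
  have "(\<integral>\<^sup>+ w. ennreal (dist (X w) x0 powr p) \<partial>N)
    \<le> (\<integral>\<^sup>+ w. ennreal (2 powr p) * (ennreal (dist (X w) (Y w) powr p) + ennreal (dist (Y w) x0 powr p)) \<partial>N)"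
    using p dist_powr_triangle[of p]
    by (intro nn_integral_mono) (simp flip: ennreal_mult ennreal_plus add: ennreal_leI)
  then show ?thesis
    by (simp add: nn_integral_cmult nn_integral_add)
qed

lemma finite_moment_any_center:
  fixes \<nu> :: "'a::polish_space measure"
  assumes \<nu>: "\<nu> \<in> borel_probs" and moment: "finite_moment p \<nu>" and p: "1 \<le> p"
  shows "(\<integral>\<^sup>+ x. ennreal (dist x x0 powr p) \<partial>\<nu>) < \<infinity>"
proof -
  interpret prob_space \<nu> using \<nu> by (simp add: borel_probs_def)
  have [measurable_cong]: "sets \<nu> = sets borel"
    using \<nu> by (simp add: borel_probs_def)
  obtain x1 where x1: "(\<integral>\<^sup>+ x. ennreal (dist x x1 powr p) \<partial>\<nu>) < \<infinity>"
    using moment by (auto simp: finite_moment_def)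
  have "(\<integral>\<^sup>+ x. ennreal (dist x x0 powr p) \<partial>\<nu>)
    \<le> ennreal (2 powr p) * ((\<integral>\<^sup>+ x. ennreal (dist x x1 powr p) \<partial>\<nu>) + ennreal (dist x1 x0 powr p))"
    using moment_le_cost_plus_moment[of "\<lambda>x. x" \<nu> "\<lambda>x. x1" p x0] p by (simp add: emeasure_space_1)
  also have "\<dots> < \<infinity>"
    using x1 by (simp add: ennreal_mult_less_top)
  finally show ?thesis .
qed

text \<open>A near-optimal coupling of \<open>\<mu>\<close> with \<open>\<nu>\<close> splits \<open>d(x, x0)\<close> into the length of the
  transport, controlled by the radius, and the distance of its endpoint from \<open>x0\<close>, controlled by the moment of
  \<open>\<nu>\<close>. Neither depends on \<open>\<mu>\<close>.\<close>

lemma ball_uniform_integral_bound: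
  fixes \<nu> :: "'a::polish_space measure"
  assumes \<nu>: "\<nu> \<in> borel_probs"
    and moment: "(\<integral>\<^sup>+ x. ennreal (dist x x0 powr p) \<partial>\<nu>) < \<infinity>"
    and p: "1 \<le> p" and r: "0 < r"
    and growth: "\<And>x. f x \<le> c * (1 + dist x x0 powr p)" and c: "0 < c"
  shows "\<exists>C\<ge>0. \<forall>\<mu> \<in> wasserstein_ball p r \<nu>. (\<integral>\<^sup>+ x. ennreal (max (f x) 0) \<partial>\<mu>) \<le> ennreal C"
proof -
  define B where "B = ennreal c * (1 + ennreal (2 powr p) *
    (ennreal ((r + 1) powr p) + (\<integral>\<^sup>+ x. ennreal (dist x x0 powr p) \<partial>\<nu>)))"
  have "B < \<infinity>"
    using moment by (simp add: B_def ennreal_mult_less_top)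
  then obtain C where C: "0 \<le> C" "B = ennreal C"
    by (cases B) auto
  have "(\<integral>\<^sup>+ x. ennreal (max (f x) 0) \<partial>\<mu>) \<le> B" if \<mu>: "\<mu> \<in> wasserstein_ball p r \<nu>" for \<mu>
  proof -
    have [measurable_cong]: "sets \<mu> = sets borel" and "prob_space \<mu>"
      using \<mu> by (auto simp: wasserstein_ball_def borel_probs_def)
    interpret prob_space \<mu> by fact
    obtain \<gamma> where \<gamma>: "\<gamma> \<in> couplings \<mu> \<nu>"
      and cost: "(\<integral>\<^sup>+ z. ennreal (dist (fst z) (snd z) powr p) \<partial>\<gamma>) \<le> ennreal ((r + 1) powr p)"
      using \<mu> p r by (rule wasserstein_ball_coupling)
    have [measurable_cong]: "sets \<gamma> = sets borel"
      and marginals: "\<mu> = distr \<gamma> borel fst" "\<nu> = distr \<gamma> borel snd"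
      using \<gamma> by (auto simp: couplings_def borel_probs_def)
    have [measurable]: "fst \<in> measurable \<gamma> (borel :: 'a measure)"
      "snd \<in> measurable \<gamma> (borel :: 'a measure)"
      using measurable_proj_borel by measurable
    have "(\<integral>\<^sup>+ x. ennreal (dist x x0 powr p) \<partial>\<mu>) = (\<integral>\<^sup>+ z. ennreal (dist (fst z) x0 powr p) \<partial>\<gamma>)"
      unfolding marginals(1) by (subst nn_integral_distr) auto
    also have "\<dots> \<le> ennreal (2 powr p) * ((\<integral>\<^sup>+ z. ennreal (dist (fst z) (snd z) powr p) \<partial>\<gamma>)
        + (\<integral>\<^sup>+ z. ennreal (dist (snd z) x0 powr p) \<partial>\<gamma>))"
      using p by (intro moment_le_cost_plus_moment) auto
    also have "(\<integral>\<^sup>+ z. ennreal (dist (snd z) x0 powr p) \<partial>\<gamma>) = (\<integral>\<^sup>+ x. ennreal (dist x x0 powr p) \<partial>\<nu>)"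
      unfolding marginals(2) by (subst nn_integral_distr) auto
    finally have moment\<mu>: "(\<integral>\<^sup>+ x. ennreal (dist x x0 powr p) \<partial>\<mu>) \<le> ennreal (2 powr p) *
        (ennreal ((r + 1) powr p) + (\<integral>\<^sup>+ x. ennreal (dist x x0 powr p) \<partial>\<nu>))"
      using cost by (meson add_right_mono mult_left_mono order_trans zero_le)
    have "(\<integral>\<^sup>+ x. ennreal (max (f x) 0) \<partial>\<mu>) \<le> (\<integral>\<^sup>+ x. ennreal c * (1 + ennreal (dist x x0 powr p)) \<partial>\<mu>)"
    proof (rule nn_integral_mono)
      fix x
      have "max (f x) 0 \<le> c * (1 + dist x x0 powr p)"
        using growth[of x] c by simp
      then have "ennreal (max (f x) 0) \<le> ennreal (c * (1 + dist x x0 powr p))"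
        by (rule ennreal_leI)
      also have "\<dots> = ennreal c * (1 + ennreal (dist x x0 powr p))"
        using c by (simp add: ennreal_mult flip: ennreal_1)
      finally show "ennreal (max (f x) 0) \<le> ennreal c * (1 + ennreal (dist x x0 powr p))" .
    qed
    also have "\<dots> = ennreal c * (1 + (\<integral>\<^sup>+ x. ennreal (dist x x0 powr p) \<partial>\<mu>))"
      by (simp add: nn_integral_cmult nn_integral_add emeasure_space_1)
    also have "\<dots> \<le> B"
      unfolding B_def by (intro mult_left_mono add_left_mono moment\<mu>) simp
    finally show ?thesis .
  qed
  with C show ?thesis by auto
qed

section \<open>Perturbations inside the ball\<close>

text \<open>The identity map is a pointwise limit of simple functions \<open>F i\<close> with
  \<open>d(F i y, x0) \<le> 2 d(y, x0)\<close>. Hence \<open>d(F i y, y)\<^sup>p\<close> tends to zero and is dominated by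
  \<open>3\<^sup>p d(y, x0)\<^sup>p\<close>, which is integrable by the moment assumption.\<close>

lemma finite_range_approximation:
  fixes \<nu> :: "'a::polish_space measure"
  assumes \<nu>: "\<nu> \<in> borel_probs"
    and moment: "(\<integral>\<^sup>+ x. ennreal (dist x x0 powr p) \<partial>\<nu>) < \<infinity>"
    and p: "1 \<le> p" and e: "0 < e"
  obtains T where "T \<in> measurable borel (borel :: 'a measure)" "finite (range T)"
    "(\<integral>\<^sup>+ y. ennreal (dist (T y) y powr p) \<partial>\<nu>) \<le> ennreal e"
proof -
  obtain F :: "nat \<Rightarrow> 'a \<Rightarrow> 'a" where simple: "\<And>i. simple_function borel (F i)"
    and lim: "\<And>y. (\<lambda>i. F i y) \<longlonglongrightarrow> y"
    and bound: "\<And>i y. dist (F i y) x0 \<le> 2 * dist y x0"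
    using borel_measurable_implies_sequence_metric[of "\<lambda>y::'a. y" borel x0] by auto
  have sets: "sets \<nu> = sets borel"
    using \<nu> by (simp add: borel_probs_def)
  have meas: "F i \<in> measurable borel borel" for i
    using simple by (rule borel_measurable_simple_function)
  have [measurable]: "F i \<in> measurable \<nu> borel" "(\<lambda>y. y) \<in> measurable \<nu> borel" for i
    using meas by (simp_all add: measurable_cong_sets[OF sets refl])
  have dom: "dist (F i y) y powr p \<le> 3 powr p * dist y x0 powr p" for i y
  proof -
    have "dist (F i y) y \<le> dist (F i y) x0 + dist y x0"
      by (rule dist_triangle2)
    with bound[of i y] have "dist (F i y) y \<le> 3 * dist y x0"
      by linarith
    then have "dist (F i y) y powr p \<le> (3 * dist y x0) powr p"
      using p by (intro powr_mono2) auto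
    then show ?thesis by (simp add: powr_mult)
  qed
  have "(\<lambda>i. \<integral>\<^sup>+ y. ennreal (dist (F i y) y powr p) \<partial>\<nu>) \<longlonglongrightarrow> (\<integral>\<^sup>+ y. 0 \<partial>\<nu>)"
  proof (rule nn_integral_dominated_convergence[where w = "\<lambda>y. ennreal (3 powr p) * ennreal (dist y x0 powr p)"])
    show "(\<integral>\<^sup>+ y. ennreal (3 powr p) * ennreal (dist y x0 powr p) \<partial>\<nu>) < \<infinity>"
      using moment by (simp add: nn_integral_cmult ennreal_mult_less_top)
    show "AE y in \<nu>. (\<lambda>i. ennreal (dist (F i y) y powr p)) \<longlonglongrightarrow> 0"
    proof (rule AE_I2)
      fix y
      have "(\<lambda>i. dist (F i y) y) \<longlonglongrightarrow> 0"
        using lim[of y] by (rule iffD1[OF tendsto_dist_iff])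
      then have "(\<lambda>i. dist (F i y) y powr p) \<longlonglongrightarrow> 0 powr p"
        using p by (intro tendsto_powr2 tendsto_const) auto
      then show "(\<lambda>i. ennreal (dist (F i y) y powr p)) \<longlonglongrightarrow> 0"
        by (simp flip: ennreal_0)
    qed
  qed (use dom in \<open>auto simp flip: ennreal_mult intro!: ennreal_leI\<close>)
  then have "(\<lambda>i. \<integral>\<^sup>+ y. ennreal (dist (F i y) y powr p) \<partial>\<nu>) \<longlonglongrightarrow> 0"
    by simp
  then have "\<forall>\<^sub>F i in sequentially. (\<integral>\<^sup>+ y. ennreal (dist (F i y) y powr p) \<partial>\<nu>) < ennreal e"
    using e by (intro order_tendstoD(2)) auto
  then obtain i where "(\<integral>\<^sup>+ y. ennreal (dist (F i y) y powr p) \<partial>\<nu>) < ennreal e"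
    by (auto simp: eventually_sequentially)
  moreover have "finite (range (F i))"
    using simple_functionD(1)[OF simple[of i]] by simp
  ultimately show ?thesis
    using that[of "F i"] meas by auto
qed

text \<open>The lower bound for the positive part carries the growth rate of \<open>f\<close>: the weight that can be
  moved to \<open>x\<close> decays no faster than \<open>1 / (1 + d(x, x0)\<^sup>p)\<close>. The constants \<open>K\<close> and \<open>\<delta>\<close> are
  uniform in \<open>x\<close>. The measure is realised on the product of \<open>\<nu>\<close> with a coin of bias
  \<open>e\<close>: the mass at \<open>y\<close> goes to \<open>x\<close> on heads and to \<open>T y\<close> on tails.\<close>

lemma ball_contains_perturbation_toward_point:
  fixes \<nu> :: "'a::polish_space measure"
  assumes \<nu>: "\<nu> \<in> borel_probs"
    and moment: "(\<integral>\<^sup>+ x. ennreal (dist x x0 powr p) \<partial>\<nu>) < \<infinity>"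
    and p: "1 \<le> p" and r: "0 < r"
    and f: "f \<in> borel_measurable borel"
  obtains K \<delta> where "0 \<le> K" "0 < \<delta>"
    "\<And>x. \<exists>\<mu> \<in> wasserstein_ball p r \<nu>. (\<integral>\<^sup>+ y. ennreal (max (- f y) 0) \<partial>\<mu>) \<le> ennreal (K + max (- f x) 0)
       \<and> ennreal (\<delta> / (1 + dist x x0 powr p) * max (f x) 0) \<le> (\<integral>\<^sup>+ y. ennreal (max (f y) 0) \<partial>\<mu>)"
proof -
  interpret \<nu>: prob_space \<nu> using \<nu> by (simp add: borel_probs_def)
  have sets [measurable_cong]: "sets \<nu> = sets borel"
    using \<nu> by (simp add: borel_probs_def)
  define M where "M = enn2real (\<integral>\<^sup>+ x. ennreal (dist x x0 powr p) \<partial>\<nu>)"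
  have M: "(\<integral>\<^sup>+ x. ennreal (dist x x0 powr p) \<partial>\<nu>) = ennreal M" "0 \<le> M"
    using moment by (simp_all add: M_def)
  obtain T where T [measurable]: "T \<in> measurable borel borel" and finT: "finite (range T)"
    and costT: "(\<integral>\<^sup>+ y. ennreal (dist (T y) y powr p) \<partial>\<nu>) \<le> ennreal (r powr p / 2)"
    using finite_range_approximation[OF \<nu> moment p, of "r powr p / 2"] r by auto
  note f [measurable]
  (* A bound for the negative part of f on the finite range of T; the sum is a convenient
     substitute for the maximum. *)
  define K where "K = (\<Sum>z\<in>range T. max (- f z) 0)"
  have K: "max (- f (T y)) 0 \<le> K" "0 \<le> K" for y
    unfolding K_def using finT
    by (auto intro!: member_le_sum[of "T y" _ "\<lambda>z. max (- f z) 0"] sum_nonneg simp del: max.bounded_iff)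
  (* Half of the budget r^p is spent on T. With e (D + M) \<le> a below, the mass sent to x costs at
     most a 2^p, which fits into the other half; the cap at 1 keeps e a probability. *)
  define a where "a = min 1 (r powr p / 2 powr (p + 1))"
  have a: "0 < a" "a \<le> 1" "a * 2 powr p \<le> r powr p / 2"
    using r by (auto simp: a_def powr_add min_def field_simps)
  show ?thesis
  proof (rule that[of K "a / (M + 1)"])
    show "0 \<le> K" "0 < a / (M + 1)" using K(2) a(1) M(2) by auto
    fix x
    define D where "D = dist x x0 powr p"
    have D: "0 \<le> D" by (simp add: D_def)
    define e where "e = a / (D + M + 1)"
    have e: "0 \<le> e" "e \<le> 1" "e * (D + M) \<le> a"
    proof -
      have "e * (D + M) = a * ((D + M) / (D + M + 1))"
        by (simp add: e_def)
      also have "\<dots> \<le> a * 1"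
        using a D M(2) by (intro mult_left_mono) auto
      finally show "e * (D + M) \<le> a" by simp
    qed (use a D M(2) in \<open>auto simp: e_def\<close>)
    define N where "N = \<nu> \<Otimes>\<^sub>M measure_pmf (bernoulli_pmf e)"
    define X where "X = (\<lambda>w :: 'a \<times> bool. if snd w then x else T (fst w))"
    interpret P: pair_prob_space \<nu> "measure_pmf (bernoulli_pmf e)" ..
    have [simp]: "X (y, True) = x" "X (y, False) = T y" for y
      by (simp_all add: X_def)
    have N: "prob_space N"
      unfolding N_def by (rule P.prob_space_axioms)
    have Xm [measurable]: "X \<in> measurable N borel"
      unfolding X_def N_def by measurable
    have Ym [measurable]: "fst \<in> measurable N borel"
      unfolding N_def by measurable
    have int: "(\<integral>\<^sup>+ w. g w \<partial>N) = (\<integral>\<^sup>+ y. ennreal e * g (y, True) + ennreal (1 - e) * g (y, False) \<partial>\<nu>)"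
      if [measurable]: "g \<in> borel_measurable N" for g
    proof -
      have "(\<integral>\<^sup>+ w. g w \<partial>N) = (\<integral>\<^sup>+ y. \<integral>\<^sup>+ b. g (y, b) \<partial>measure_pmf (bernoulli_pmf e) \<partial>\<nu>)"
        using that unfolding N_def by (simp add: measure_pmf.nn_integral_fst)
      then show ?thesis using e by (simp add: mult.commute)
    qed
    have marginal: "distr N borel fst = \<nu>"
    proof -
      have "distr N borel fst = distr N \<nu> fst"
        by (rule distr_cong) (simp_all add: sets)
      then show ?thesis
        unfolding N_def by (simp add: measure_pmf.distr_pair_fst)
    qed
    have far: "(\<integral>\<^sup>+ y. ennreal (dist x y powr p) \<partial>\<nu>) \<le> ennreal (2 powr p * (D + M))"
    proof -
      have "(\<integral>\<^sup>+ y. ennreal (dist x y powr p) \<partial>\<nu>) = (\<integral>\<^sup>+ y. ennreal (dist y x powr p) \<partial>\<nu>)"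
        by (simp add: dist_commute)
      also have "\<dots> \<le> (\<integral>\<^sup>+ y. ennreal (2 powr p) * (ennreal (dist y x0 powr p) + ennreal D) \<partial>\<nu>)"
        using p dist_powr_triangle[of p _ x x0] unfolding D_def
        by (intro nn_integral_mono)
          (simp flip: ennreal_mult ennreal_plus add: ennreal_leI dist_commute[of x x0])
      also have "\<dots> = ennreal (2 powr p * (D + M))"
        using D M by (simp add: nn_integral_cmult nn_integral_add \<nu>.emeasure_space_1 ennreal_mult add.commute)
      finally show ?thesis .
    qed
    have "(\<integral>\<^sup>+ w. ennreal (dist (X w) (fst w) powr p) \<partial>N)
      = ennreal e * (\<integral>\<^sup>+ y. ennreal (dist x y powr p) \<partial>\<nu>)
        + ennreal (1 - e) * (\<integral>\<^sup>+ y. ennreal (dist (T y) y powr p) \<partial>\<nu>)"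
      by (subst int) (simp_all add: nn_integral_add nn_integral_cmult)
    also have "\<dots> \<le> ennreal e * ennreal (2 powr p * (D + M)) + 1 * ennreal (r powr p / 2)"
      using far costT e by (intro add_mono mult_mono) auto
    also have "\<dots> = ennreal (e * (D + M) * 2 powr p + r powr p / 2)"
      using e D M by (simp flip: ennreal_mult ennreal_plus add: mult_ac)
    also have "\<dots> \<le> ennreal (r powr p)"
    proof (rule ennreal_leI)
      have "e * (D + M) * 2 powr p \<le> a * 2 powr p"
        using e by (intro mult_right_mono) auto
      with a(3) show "e * (D + M) * 2 powr p + r powr p / 2 \<le> r powr p"
        by linarith
    qed
    finally have ball: "distr N borel X \<in> wasserstein_ball p r \<nu>"
      using distr_in_wasserstein_ball[OF N Xm Ym marginal _ p r] by blast
    have neg: "(\<integral>\<^sup>+ y. ennreal (max (- f y) 0) \<partial>distr N borel X) \<le> ennreal (K + max (- f x) 0)"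
    proof -
      interpret N: prob_space N by (rule N)
      have "(\<integral>\<^sup>+ y. ennreal (max (- f y) 0) \<partial>distr N borel X) = (\<integral>\<^sup>+ w. ennreal (max (- f (X w)) 0) \<partial>N)"
        by (subst nn_integral_distr) auto
      also have "\<dots> \<le> (\<integral>\<^sup>+ w. ennreal (K + max (- f x) 0) \<partial>N)"
        using K by (intro nn_integral_mono ennreal_leI) (auto simp: X_def intro: add_increasing2)
      finally show ?thesis by (simp add: N.emeasure_space_1)
    qed
    have pos: "ennreal (e * max (f x) 0) \<le> (\<integral>\<^sup>+ y. ennreal (max (f y) 0) \<partial>distr N borel X)"
    proof -
      have "(\<integral>\<^sup>+ y. ennreal (max (f y) 0) \<partial>distr N borel X) = (\<integral>\<^sup>+ w. ennreal (max (f (X w)) 0) \<partial>N)"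
        by (subst nn_integral_distr) auto
      also have "\<dots> = (\<integral>\<^sup>+ y. ennreal e * ennreal (max (f x) 0) + ennreal (1 - e) * ennreal (max (f (T y)) 0) \<partial>\<nu>)"
        by (subst int) simp_all
      also have "\<dots> \<ge> (\<integral>\<^sup>+ y. ennreal (e * max (f x) 0) \<partial>\<nu>)"
        using e by (intro nn_integral_mono) (simp add: ennreal_mult)
      finally show ?thesis by (simp add: \<nu>.emeasure_space_1)
    qed
    (* Removes M from the denominator of e, at the price of a smaller numerator. *)
    have "a / (M + 1) / (1 + D) \<le> e"
    proof -
      have "D + M + 1 \<le> (M + 1) * (1 + D)"
        using D M(2) by (simp add: algebra_simps)
      then show ?thesis
        using D M(2) a(1) by (simp add: e_def frac_le)
    qed
    then have "ennreal (a / (M + 1) / (1 + D) * max (f x) 0) \<le> ennreal (e * max (f x) 0)"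
      by (intro ennreal_leI mult_right_mono) auto
    with pos neg ball show "\<exists>\<mu> \<in> wasserstein_ball p r \<nu>.
        (\<integral>\<^sup>+ y. ennreal (max (- f y) 0) \<partial>\<mu>) \<le> ennreal (K + max (- f x) 0)
       \<and> ennreal (a / (M + 1) / (1 + dist x x0 powr p) * max (f x) 0) \<le> (\<integral>\<^sup>+ y. ennreal (max (f y) 0) \<partial>\<mu>)"
      unfolding D_def by (blast intro: order_trans)
  qed
qed

theorem theorem2:
  fixes \<nu> :: "'a::polish_space measure"
    and f :: "'a \<Rightarrow> real"
    and p r :: real
  assumes proper: "\<And>(x0::'a) R. R > 0 \<Longrightarrow> compact (cball x0 R)"
    and p: "1 \<le> p"
    and r: "0 < r"
    and \<nu>: "\<nu> \<in> borel_probs"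
    and moment: "finite_moment p \<nu>"
    and usc: "upper_semicontinuous f"
    and well_defined: "\<And>\<mu>. \<mu> \<in> wasserstein_ball p r \<nu> \<Longrightarrow>
      (\<integral>\<^sup>+ x. ennreal (max (f x) 0) \<partial>\<mu>) < \<infinity> \<or> (\<integral>\<^sup>+ x. ennreal (max (- f x) 0) \<partial>\<mu>) < \<infinity>"
  shows "\<bar>SUP \<mu> \<in> wasserstein_ball p r \<nu>. ext_integral \<mu> f\<bar> \<noteq> \<infinity> \<longleftrightarrow>
    (\<exists>x0::'a. \<exists>c>0. \<forall>x. f x \<le> c * (1 + dist x x0 powr p))"
proof
  assume fin: "\<bar>SUP \<mu> \<in> wasserstein_ball p r \<nu>. ext_integral \<mu> f\<bar> \<noteq> \<infinity>"
  obtain x0 where x0: "(\<integral>\<^sup>+ x. ennreal (dist x x0 powr p) \<partial>\<nu>) < \<infinity>"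
    using moment by (auto simp: finite_moment_def)
  obtain K \<delta> where K: "0 \<le> K" "0 < \<delta>"
    and perturb: "\<And>x. \<exists>\<mu> \<in> wasserstein_ball p r \<nu>. (\<integral>\<^sup>+ y. ennreal (max (- f y) 0) \<partial>\<mu>) \<le> ennreal (K + max (- f x) 0)
       \<and> ennreal (\<delta> / (1 + dist x x0 powr p) * max (f x) 0) \<le> (\<integral>\<^sup>+ y. ennreal (max (f y) 0) \<partial>\<mu>)"
    by (rule ball_contains_perturbation_toward_point[OF \<nu> x0 p r usc_borel_measurable[OF usc]]) blast
  obtain S where S: "(SUP \<mu> \<in> wasserstein_ball p r \<nu>. ext_integral \<mu> f) = ereal S"
    using fin by (auto simp: ereal_infinity_cases)
  define c where "c = (\<bar>S\<bar> + K + 1) / \<delta>"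
  have c: "0 < c" using K by (auto simp: c_def intro!: divide_pos_pos)
  have "f x \<le> c * (1 + dist x x0 powr p)" for x
  proof (cases "f x \<le> 0")
    case True
    also have "0 \<le> c * (1 + dist x x0 powr p)"
      using c by simp
    finally show ?thesis .
  next
    case False
    then obtain \<mu> where \<mu>: "\<mu> \<in> wasserstein_ball p r \<nu>"
      and neg: "(\<integral>\<^sup>+ y. ennreal (max (- f y) 0) \<partial>\<mu>) \<le> ennreal K"
      and pos: "ennreal (\<delta> / (1 + dist x x0 powr p) * f x) \<le> (\<integral>\<^sup>+ y. ennreal (max (f y) 0) \<partial>\<mu>)"
      using perturb[of x] by (auto simp: max_def)
    have "ereal (\<delta> / (1 + dist x x0 powr p) * f x) - ereal K \<le> ext_integral \<mu> f"
      unfolding ext_integral_def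
    proof (rule ereal_minus_mono)
      show "ereal (\<delta> / (1 + dist x x0 powr p) * f x) \<le> enn2ereal (\<integral>\<^sup>+ y. ennreal (max (f y) 0) \<partial>\<mu>)"
        using pos K False by (simp add: less_eq_ennreal.rep_eq enn2ereal_ennreal)
      show "enn2ereal (\<integral>\<^sup>+ y. ennreal (max (- f y) 0) \<partial>\<mu>) \<le> ereal K"
        using neg K by (simp add: less_eq_ennreal.rep_eq enn2ereal_ennreal)
    qed
    also have "\<dots> \<le> ereal S"
      unfolding S[symmetric] using \<mu> by (rule SUP_upper)
    finally have "\<delta> / (1 + dist x x0 powr p) * f x \<le> \<bar>S\<bar> + K + 1"
      by simp
    moreover have "0 < 1 + dist x x0 powr p"
      by (simp add: add_pos_nonneg)
    ultimately show ?thesis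
      using K by (simp add: c_def field_simps)
  qed
  with c show "\<exists>x0::'a. \<exists>c>0. \<forall>x. f x \<le> c * (1 + dist x x0 powr p)"
    by blast
next
  assume "\<exists>x0::'a. \<exists>c>0. \<forall>x. f x \<le> c * (1 + dist x x0 powr p)"
  then obtain x0 c where c: "0 < c" and growth: "\<And>x. f x \<le> c * (1 + dist x x0 powr p)"
    by blast
  have x0: "(\<integral>\<^sup>+ x. ennreal (dist x x0 powr p) \<partial>\<nu>) < \<infinity>"
    using moment p \<nu> by (intro finite_moment_any_center)
  then obtain C where C: "0 \<le> C" and up: "\<And>\<mu>. \<mu> \<in> wasserstein_ball p r \<nu> \<Longrightarrow> (\<integral>\<^sup>+ x. ennreal (max (f x) 0) \<partial>\<mu>) \<le> ennreal C"
    using ball_uniform_integral_bound[OF \<nu> x0 p r growth c] by blast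
  have upper: "(SUP \<mu> \<in> wasserstein_ball p r \<nu>. ext_integral \<mu> f) \<le> ereal C"
  proof (rule SUP_least)
    fix \<mu> assume "\<mu> \<in> wasserstein_ball p r \<nu>"
    then have "enn2ereal (\<integral>\<^sup>+ x. ennreal (max (f x) 0) \<partial>\<mu>) \<le> ereal C"
      using up C by (metis enn2ereal_ennreal less_eq_ennreal.rep_eq)
    then have "ext_integral \<mu> f \<le> ereal C - 0"
      unfolding ext_integral_def by (intro ereal_minus_mono) simp_all
    then show "ext_integral \<mu> f \<le> ereal C" by simp
  qed
  (* A perturbation toward any point, here x0, has a finite integral of the negative part. *)
  obtain K \<mu> where "0 \<le> K" and \<mu>: "\<mu> \<in> wasserstein_ball p r \<nu>"
    and neg: "(\<integral>\<^sup>+ y. ennreal (max (- f y) 0) \<partial>\<mu>) \<le> ennreal K"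
  proof -
    obtain K \<delta> where "0 \<le> K"
      and "\<And>x. \<exists>\<mu> \<in> wasserstein_ball p r \<nu>. (\<integral>\<^sup>+ y. ennreal (max (- f y) 0) \<partial>\<mu>) \<le> ennreal (K + max (- f x) 0)"
      by (rule ball_contains_perturbation_toward_point[OF \<nu> x0 p r usc_borel_measurable[OF usc]]) blast
    then show ?thesis
      using that[of "K + max (- f x0) 0"] by fastforce
  qed
  have lower: "- ereal K \<le> (SUP \<mu> \<in> wasserstein_ball p r \<nu>. ext_integral \<mu> f)"
  proof (rule SUP_upper2[OF \<mu>])
    have "enn2ereal (\<integral>\<^sup>+ y. ennreal (max (- f y) 0) \<partial>\<mu>) \<le> ereal K"
      using neg \<open>0 \<le> K\<close> by (simp add: less_eq_ennreal.rep_eq enn2ereal_ennreal)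
    then have "0 - ereal K \<le> ext_integral \<mu> f"
      unfolding ext_integral_def by (intro ereal_minus_mono) simp_all
    then show "- ereal K \<le> ext_integral \<mu> f" by simp
  qed
  from upper lower show "\<bar>SUP \<mu> \<in> wasserstein_ball p r \<nu>. ext_integral \<mu> f\<bar> \<noteq> \<infinity>"
    by (auto simp: ereal_infinity_cases)
qed

end
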